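(* Let $n \ge 1$ and let $\mathrm{PAR}_n(x_1,\dots,x_n)=x_1\oplus x_2\oplus\dots\oplus x_n$. Let $F(x_1,\dots,x_n,y_1,\dots,y_s)$ be a CNF encoding of $\mathrm{PAR}_n$ with $m$ clauses, $s$ non-deterministic variables, and maximum clause width $k$. Then: 1. $m \ge \Omega\left(\frac{s+1}{n}\cdot 2^{n/(s+1)}\right)$, i.e., there is an absolute constant $c>0$ such that $m \ge c\cdot\frac{s+1}{n}\cdot 2^{n/(s+1)}$ for every such encoding; 2. $k \ge n/(s+1)$; 3. $m \ge 3n-9$.
   Context: A CNF is treated as a set of clauses (disjunctions of literals, i.e. of variables or their negations); its size is its number of clauses, and the width of a clause is its number of literals. A CNF $F(x_1,\dots,x_n,y_1,\dots,y_s)$ encodes a Boolean function $f\colon\{0,1\}^n\to\{0,1\}$ if for every $x\in\{0,1\}^n$, $f(x)=1$ if and only if there exists $y\in\{0,1\}^s$ with $F(x,y)=1$. The variables $y_1,\dots,y_s$ are called non-deterministic (guess) variables; $x_1,\dots,x_n$ are the deterministic (input) variables.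
   Formalization: Part 1 is proved under the added hypothesis s ≤ n·m, because as stated it fails: {{x_1}}, or {{x_1},{x_1,y_1,…,y_s}} if all guess variables must occur, encodes PAR_1 with at most two clauses for arbitrarily large s. *)

theory Defs
  imports Complex_Main
begin

datatype 'v literal = Pos 'v | Neg 'v

type_synonym 'v clause = "'v literal set"
type_synonym 'v cnf = "'v clause set"

fun lit_var :: "'v literal \<Rightarrow> 'v" where
  "lit_var (Pos v) = v"
| "lit_var (Neg v) = v"

fun lit_sat :: "('v \<Rightarrow> bool) \<Rightarrow> 'v literal \<Rightarrow> bool" where
  "lit_sat a (Pos v) \<longleftrightarrow> a v"
| "lit_sat a (Neg v) \<longleftrightarrow> \<not> a v"

definition clause_sat :: "('v \<Rightarrow> bool) \<Rightarrow> 'v clause \<Rightarrow> bool" where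
  "clause_sat a C \<longleftrightarrow> (\<exists>l\<in>C. lit_sat a l)"

definition cnf_sat :: "('v \<Rightarrow> bool) \<Rightarrow> 'v cnf \<Rightarrow> bool" where
  "cnf_sat a F \<longleftrightarrow> (\<forall>C\<in>F. clause_sat a C)"

definition cnf_size :: "'v cnf \<Rightarrow> nat" where
  "cnf_size F = card F"

definition clause_width :: "'v clause \<Rightarrow> nat" where
  "clause_width C = card C"

(* Max is unspecified on the empty set, but the CNF without clauses only
   encodes constant functions, hence never PAR n with n >= 1. *)
definition max_width :: "'v cnf \<Rightarrow> nat" where
  "max_width F = Max (clause_width ` F)"

(* X i is the i-th deterministic variable, Y j the j-th non-deterministic one;
   both are numbered from 0. *)
datatype var = X nat | Y nat

definition vars :: "nat \<Rightarrow> nat \<Rightarrow> var set" where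
  "vars n s = X ` {..<n} \<union> Y ` {..<s}"

definition is_cnf :: "nat \<Rightarrow> nat \<Rightarrow> var cnf \<Rightarrow> bool" where
  "is_cnf n s F \<longleftrightarrow>
     finite F \<and> (\<forall>C\<in>F. finite C \<and> lit_var ` C \<subseteq> vars n s)"

(* Points of the n-cube are total functions nat => bool, of which only the
   values at 0, ..., n - 1 matter (similarly s for the guesses). The assignment
   case_var x y maps X i to x i and Y j to y j.
   A non-deterministic variable is allowed not to occur in F. *)
definition encodes :: "nat \<Rightarrow> nat \<Rightarrow> var cnf \<Rightarrow> ((nat \<Rightarrow> bool) \<Rightarrow> bool) \<Rightarrow> bool" where
  "encodes n s F f \<longleftrightarrow>
     is_cnf n s F \<and>
     (\<forall>x :: nat \<Rightarrow> bool. f x \<longleftrightarrow> (\<exists>y :: nat \<Rightarrow> bool. cnf_sat (case_var x y) F))"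

(* On bool, the exclusive or is inequality. *)
primrec PAR :: "nat \<Rightarrow> (nat \<Rightarrow> bool) \<Rightarrow> bool" where
  "PAR 0 x \<longleftrightarrow> False"
| "PAR (Suc n) x \<longleftrightarrow> (PAR n x \<noteq> x n)"

(* A lower bound m >= c * (s + 1) / n * 2 powr (n / (s + 1)) on the size forces
   s + 1 <= n * m / c, whereas s is not bounded in terms of n and m: a guess
   variable need not occur, and even if all of them must, the encoding
   {{x_0}, {x_0, y_0, ..., y_(s-1)}} of PAR 1 has two clauses. So the bound
   fails without a restriction s <= n * m (up to a constant factor). *)
lemma unbounded_guesses:
  "encodes 1 s {{Pos (X 0)}} (PAR 1)"
  by (auto simp: encodes_def is_cnf_def vars_def cnf_sat_def clause_sat_def)

lemma no_size_bound_for_unbounded_guesses: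
  "\<not> (\<exists>c::real. c > 0 \<and> (\<forall>n s F m. n \<ge> 1 \<and> encodes n s F (PAR n) \<and> m = cnf_size F \<longrightarrow>
         real m \<ge> c * ((real s + 1) / real n) * 2 powr (real n / (real s + 1))))"
proof
  assume "\<exists>c::real. c > 0 \<and> (\<forall>n s F m. n \<ge> 1 \<and> encodes n s F (PAR n) \<and> m = cnf_size F \<longrightarrow>
         real m \<ge> c * ((real s + 1) / real n) * 2 powr (real n / (real s + 1)))"
  then obtain c::real where c: "c > 0" and *: "\<And>n s F m. n \<ge> 1 \<and> encodes n s F (PAR n) \<and> m = cnf_size F \<Longrightarrow>
         real m \<ge> c * ((real s + 1) / real n) * 2 powr (real n / (real s + 1))" by blast
  obtain s :: nat where s: "real s > 1 / c" using reals_Archimedean2 by blast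
  have "1 \<ge> c * (real s + 1) * 2 powr (1 / (real s + 1))"
    using *[of 1 s "{{Pos (X 0)}}" 1] unbounded_guesses[of s] by (simp add: cnf_size_def)
  moreover have "(2::real) powr (1 / (real s + 1)) \<ge> 1" by (simp add: ge_one_powr_ge_zero)
  moreover have "c * (real s + 1) > 1" using s c by (simp add: field_simps)
  ultimately show False
    using mult_left_mono[of 1 "2 powr (1 / (real s + 1))" "c * (real s + 1)"] by linarith
qed

end

theory Submission imports Defs
begin

text \<open>For fixed guesses, all solutions are isolated, so each input bit of a solution has a critical
  clause, which determines it from the other input bits of that clause. A solution can thus be
  encoded, by the Satisfiability Coding Lemma, in at most \<open>n - (\<Sum>i. 1 / w i)\<close> bits on average,
  where \<open>w i\<close> is the number of inputs in the critical clause of bit \<open>i\<close>. Since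
  \<open>2 ^ (n - 1)\<close> solutions are covered by \<open>2 ^ s\<close> guesses, the average of \<open>\<Sum>i. 1 / w i\<close>
  is at most \<open>s + 1\<close>, which bounds the width. As a clause with \<open>w\<close> inputs is critical for at most
  \<open>w * 2 ^ (n - w)\<close> pairs of a solution and a bit, convexity bounds the size.

  The bound \<open>3 * n - 9\<close> is a gate elimination argument on an encoding with the fewest clauses:
  restricting one input removes three clauses, or restricting two inputs removes six, or every
  input literal occurs twice and no clause contains two inputs, which makes \<open>4 * n\<close> clauses.\<close>

section \<open>Width and size bounds by solution coding\<close>

text \<open>Jensen's inequality in tangent form: \<open>2 powr t\<close> lies above its tangent at
  \<open>c\<close>. If \<open>c\<close> is the average of \<open>f\<close>, the linear term
  vanishes.\<close>

lemma sum_powr_ge_tangent: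
  fixes f :: "'a \<Rightarrow> real"
  shows "(\<Sum>i\<in>A. 2 powr f i) \<ge> 2 powr c * (real (card A) + ln 2 * ((\<Sum>i\<in>A. f i) - c * real (card A)))"
proof -
  have "2 powr f i \<ge> 2 powr c * (1 + ln 2 * (f i - c))" for i
  proof -
    have "2 powr f i = 2 powr c * exp (ln 2 * (f i - c))"
      by (simp add: powr_def exp_add[symmetric] algebra_simps)
    then show ?thesis
      using exp_ge_add_one_self[of "ln 2 * (f i - c)"] by simp
  qed
  then have "(\<Sum>i\<in>A. 2 powr c * (1 + ln 2 * (f i - c))) \<le> (\<Sum>i\<in>A. 2 powr f i)"
    by (intro sum_mono) auto
  moreover have "(\<Sum>i\<in>A. 2 powr c * (1 + ln 2 * (f i - c)))
      = 2 powr c * (real (card A) + ln 2 * ((\<Sum>i\<in>A. f i) - c * real (card A)))"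
    by (simp add: sum_distrib_left[symmetric] sum.distrib sum_subtractf)
  ultimately show ?thesis by simp
qed

text \<open>This is the average in the coding argument: bit \<open>i\<close> is read first, and the
  summand is the chance that \<open>j\<close> is still omitted. The bits of \<open>D - {j}\<close>
  contribute 1 in total, replaced by the summand \<open>i = j\<close> if \<open>D = {j}\<close>, and
  those outside \<open>D\<close> contribute \<open>1 / card D\<close> each.\<close>

lemma sum_inverse_card_removed:
  assumes V: "finite V" and D: "j \<in> D" "D \<subseteq> V"
  shows "(\<Sum>i\<in>V. if i = j then (if card D = 1 then 1 else 0) else 1 / real (card (D - {i})))
    = real (card V) / real (card D)"
proof -
  note fD = finite_subset[OF D(2) V]
  let ?w = "card D" and ?n = "card V"
  let ?f = "\<lambda>i. if i = j then (if ?w = 1 then 1 else 0) else 1 / real (card (D - {i}))"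
  have w: "?w \<ge> 1" using D fD by (metis One_nat_def Suc_leI card_gt_0_iff empty_iff)
  have n: "?n \<ge> ?w" using D V by (simp add: card_mono)
  have "sum ?f V = ?f j + sum ?f (D - {j}) + sum ?f (V - D)"
  proof -
    have "V = insert j ((D - {j}) \<union> (V - D))" using D by auto
    then have "sum ?f V = sum ?f (insert j ((D - {j}) \<union> (V - D)))" by simp
    also have "\<dots> = ?f j + sum ?f ((D - {j}) \<union> (V - D))"
      using V fD D by (intro sum.insert) auto
    also have "sum ?f ((D - {j}) \<union> (V - D)) = sum ?f (D - {j}) + sum ?f (V - D)"
      using V fD by (intro sum.union_disjoint) auto
    finally show ?thesis by simp
  qed
  also have "sum ?f (D - {j}) = (\<Sum>i\<in>D - {j}. 1 / real (?w - 1))"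
    using fD by (intro sum.cong) auto
  also have "sum ?f (V - D) = (\<Sum>i\<in>V - D. 1 / real ?w)"
    using D by (intro sum.cong) auto
  finally have "sum ?f V = ?f j + real (?w - 1) * (1 / real (?w - 1)) + real (?n - ?w) * (1 / real ?w)"
    using fD D V by (simp add: card_Diff_subset)
  also have "\<dots> = 1 + real (?n - ?w) / real ?w"
    using w by (cases "?w = 1") auto
  also have "\<dots> = real ?n / real ?w"
    using w n by (simp add: of_nat_diff field_simps)
  finally show ?thesis .
qed

text \<open>A form of the Satisfiability Coding Lemma of Paturi, Pudlak and Zane: in an isolated solution
  \<open>x\<close>, the bit \<open>i\<close> is determined by the other bits in \<open>D x i\<close>. The encoder reads the bits in random
  order and omits \<open>x i\<close> if it comes last in \<open>D x i\<close>, which has probability \<open>1 / card (D x i)\<close>; the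
  claim is Kraft's inequality for this code. The induction averages over the first bit read.\<close>

lemma kraft_isolated:
  fixes V :: "'a set" and S :: "('a \<Rightarrow> bool) set"
  assumes "finite V" "finite S"
    and "\<And>x z. x \<in> S \<Longrightarrow> z \<in> S \<Longrightarrow> (\<And>i. i \<in> V \<Longrightarrow> x i = z i) \<Longrightarrow> x = z"
    and "\<And>x i. x \<in> S \<Longrightarrow> i \<in> V \<Longrightarrow> i \<in> D x i \<and> D x i \<subseteq> V"
    and "\<And>x z i. x \<in> S \<Longrightarrow> z \<in> S \<Longrightarrow> i \<in> V \<Longrightarrow> (\<And>j. j \<in> D x i - {i} \<Longrightarrow> z j = x j) \<Longrightarrow> z i = x i"
  shows "(\<Sum>x\<in>S. 2 powr (\<Sum>i\<in>V. 1 / real (card (D x i)))) \<le> 2 ^ card V"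
  using assms
proof (induction "card V" arbitrary: V S D)
  case 0
  have V: "V = {}" using "0.hyps" "0.prems"(1) by simp
  have "x = z" if "x \<in> S" "z \<in> S" for x z
    using "0.prems"(3)[OF that] V by simp
  then have "card S \<le> 1"
    using card_le_Suc0_iff_eq[OF "0.prems"(2)] unfolding One_nat_def by blast
  then have "real (card S) \<le> 1" by linarith
  then show ?case unfolding V by simp
next
  case (Suc n)
  note V = Suc.prems(1) and S = Suc.prems(2) and inj = Suc.prems(3)
    and D = Suc.prems(4) and iso = Suc.prems(5)
  \<comment> \<open>The probability that bit \<open>j\<close> is omitted in the code of
    \<open>x\<close>, given that bit \<open>i\<close> is read first.\<close>
  define u where "u x i j = (if i = j then (if card (D x j) = 1 then 1 else 0)
    else 1 / real (card (D x j - {i})))" for x i j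
  have split: "(\<Sum>x\<in>S. 2 powr (\<Sum>j\<in>V. u x i j)) \<le> 2 ^ card V" if i: "i \<in> V" for i
  proof -
    define A where "A x = (\<Sum>j\<in>V - {i}. 1 / real (card (D x j - {i})))" for x
    have cV: "card (V - {i}) = n" using Suc.hyps(2) V i by simp
    have half: "(\<Sum>x\<in>{x\<in>S. x i = b}. 2 powr A x) \<le> 2 ^ n" for b
      unfolding A_def cV[symmetric]
    proof (rule Suc.hyps(1))
      fix x z j assume *: "x \<in> {x \<in> S. x i = b}" "z \<in> {x \<in> S. x i = b}" "j \<in> V - {i}"
        "\<And>k. k \<in> D x j - {i} - {j} \<Longrightarrow> z k = x k"
      have "z k = x k" if "k \<in> D x j - {j}" for k
        using * that by (cases "k = i") auto
      then show "z j = x j" using iso[of x z j] * by blast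
    next
      fix x z assume *: "x \<in> {x \<in> S. x i = b}" "z \<in> {x \<in> S. x i = b}" "\<And>j. j \<in> V - {i} \<Longrightarrow> x j = z j"
      have "x j = z j" if "j \<in> V" for j
        using * that by (cases "j = i") auto
      then show "x = z" using inj[of x z] * by blast
    qed (use cV V S D in auto)
    have AU: "(\<Sum>j\<in>V. u x i j) = A x + (if card (D x i) = 1 then 1 else 0)" for x
    proof -
      have "(\<Sum>j\<in>V - {i}. u x i j) = A x"
        unfolding A_def u_def by (intro sum.cong) auto
      then show ?thesis using V i by (simp add: sum.remove[of V i] u_def)
    qed
    have S2: "(\<Sum>x\<in>S. 2 powr A x) = (\<Sum>x\<in>{x\<in>S. x i = b}. 2 powr A x) + (\<Sum>x\<in>{x\<in>S. x i = (\<not> b)}. 2 powr A x)" for b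
      using S by (subst sum.union_disjoint[symmetric]) (auto intro!: sum.cong)
    \<comment> \<open>If \<open>D x i = {i}\<close> for some solution, then bit \<open>i\<close> is
      constant on \<open>S\<close>: one half is empty, which pays for the factor 2 of the omitted
      bit. Otherwise bit \<open>i\<close> itself saves nothing and the two halves add up.\<close>
    show ?thesis
    proof (cases "\<exists>x\<in>S. card (D x i) = 1")
      case True
      then obtain x where x: "x \<in> S" "card (D x i) = 1" by blast
      then have "D x i = {i}" using D[OF x(1) i] by (metis card_1_singletonE singletonD)
      then have "z i = x i" if "z \<in> S" for z using iso[OF x(1) that i] by simp
      then have none: "{z\<in>S. z i = (\<not> x i)} = {}" by auto
      have "(\<Sum>x\<in>S. 2 powr (\<Sum>j\<in>V. u x i j)) \<le> (\<Sum>x\<in>S. 2 * 2 powr A x)"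
        unfolding AU by (intro sum_mono) (auto simp: powr_add)
      also have "\<dots> = 2 * (\<Sum>z\<in>S. 2 powr A z)" by (rule sum_distrib_left[symmetric])
      also have "\<dots> = 2 * (\<Sum>y\<in>{z\<in>S. z i = x i}. 2 powr A y)"
        using S2[of "x i"] unfolding none by simp
      also have "\<dots> \<le> 2 * 2 ^ n" using half[of "x i"] by simp
      finally show ?thesis using Suc.hyps(2) by (metis power_Suc)
    next
      case False
      then have "(\<Sum>x\<in>S. 2 powr (\<Sum>j\<in>V. u x i j)) = (\<Sum>x\<in>S. 2 powr A x)"
        unfolding AU by (intro sum.cong) auto
      also have "\<dots> \<le> 2 * 2 ^ n" using S2[of True] half[of True] half[of False] by simp
      finally show ?thesis using Suc.hyps(2) by (metis power_Suc)
    qed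
  qed
  have n0: "real (card V) > 0" using Suc.hyps(2) by simp
  have avg: "real (card V) * 2 powr (\<Sum>j\<in>V. 1 / real (card (D x j))) \<le> (\<Sum>i\<in>V. 2 powr (\<Sum>j\<in>V. u x i j))"
    if x: "x \<in> S" for x
  proof -
    \<comment> \<open>After the interchange, the inner averages are known. The savings of
      \<open>x\<close> are then the average over the first bit, which is the tangent point for
      convexity.\<close>
    have "(\<Sum>i\<in>V. \<Sum>j\<in>V. u x i j) = (\<Sum>j\<in>V. \<Sum>i\<in>V. u x i j)" by (rule sum.swap)
    also have "\<dots> = (\<Sum>j\<in>V. real (card V) / real (card (D x j)))"
      unfolding u_def using D[OF x] by (intro sum.cong refl sum_inverse_card_removed V) auto
    also have "\<dots> = (\<Sum>j\<in>V. 1 / real (card (D x j))) * real (card V)"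
      by (simp add: sum_distrib_right)
    finally show ?thesis
      using sum_powr_ge_tangent[of "\<Sum>j\<in>V. 1 / real (card (D x j))" V "\<lambda>i. \<Sum>j\<in>V. u x i j"]
      by (simp add: mult.commute)
  qed
  have "real (card V) * (\<Sum>x\<in>S. 2 powr (\<Sum>j\<in>V. 1 / real (card (D x j)))) \<le> (\<Sum>x\<in>S. \<Sum>i\<in>V. 2 powr (\<Sum>j\<in>V. u x i j))"
    unfolding sum_distrib_left by (intro sum_mono avg)
  also have "\<dots> = (\<Sum>i\<in>V. \<Sum>x\<in>S. 2 powr (\<Sum>j\<in>V. u x i j))" by (rule sum.swap)
  also have "\<dots> \<le> (\<Sum>i\<in>V. 2 ^ card V)" by (intro sum_mono split)
  also have "\<dots> = real (card V) * 2 ^ card V" by simp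
  finally show ?case using n0 by simp
qed

section \<open>Points of the cube and their parity\<close>

lemma PAR_cong: "(\<And>i. i < n \<Longrightarrow> x i = x' i) \<Longrightarrow> PAR n x = PAR n x'"
  by (induction n) auto

lemma PAR_flip: "i < n \<Longrightarrow> PAR n (x(i := \<not> x i)) \<longleftrightarrow> \<not> PAR n x"
proof (induction n)
  case (Suc n)
  have "PAR n (x(n := \<not> x n)) = PAR n x" by (rule PAR_cong) simp
  then show ?case using Suc by (cases "i = n") (simp_all del: fun_upd_apply, simp_all)
qed simp

text \<open>Points are total functions; the default \<open>False\<close> outside \<open>V\<close>
  leaves one representative of each, so that they can be counted.\<close>

definition supported_on :: "nat set \<Rightarrow> (nat \<Rightarrow> bool) set" where
  "supported_on V = {x. \<forall>i. x i \<longrightarrow> i \<in> V}"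

lemma supported_on_eq: "supported_on V = (\<lambda>A i. i \<in> A) ` Pow V"
proof -
  have "x \<in> (\<lambda>A i. i \<in> A) ` Pow V" if "x \<in> supported_on V" for x
    using that by (intro image_eqI[of _ _ "{i. x i}"]) (auto simp: supported_on_def)
  then show ?thesis by (auto simp: supported_on_def)
qed

lemma finite_supported_on [simp]: "finite V \<Longrightarrow> finite (supported_on V)"
  by (simp add: supported_on_eq)

lemma card_supported_on: "finite V \<Longrightarrow> card (supported_on V) = 2 ^ card V"
  unfolding supported_on_eq by (subst card_image) (auto simp: inj_on_def card_Pow fun_eq_iff)

text \<open>Clearing the bits in \<open>D\<close> is injective on points with prescribed values
  there.\<close>

lemma card_supported_on_prescribed:
  assumes V: "finite V" "D \<subseteq> V"
  shows "card {x \<in> supported_on V. \<forall>j\<in>D. x j = p j} \<le> 2 ^ (card V - card D)"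
proof -
  let ?S = "{x \<in> supported_on V. \<forall>j\<in>D. x j = p j}"
  let ?r = "\<lambda>x j. x j \<and> j \<notin> D"
  have "inj_on ?r ?S" by (auto simp: inj_on_def fun_eq_iff)
  moreover have "?r ` ?S \<subseteq> supported_on (V - D)" by (auto simp: supported_on_def)
  ultimately have "card ?S \<le> card (supported_on (V - D))"
    using V by (intro card_inj_on_le[of ?r]) auto
  then show ?thesis using V by (simp add: card_supported_on card_Diff_subset finite_subset)
qed

definition PAR_ones :: "nat \<Rightarrow> (nat \<Rightarrow> bool) set" where
  "PAR_ones n = {x \<in> supported_on {..<n}. PAR n x}"

lemma finite_PAR_ones [simp]: "finite (PAR_ones n)"
  by (simp add: PAR_ones_def)

text \<open>Flipping bit 0 exchanges the points of odd and even parity.\<close>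

lemma card_PAR_ones:
  assumes "n \<ge> 1"
  shows "2 * card (PAR_ones n) = 2 ^ n"
proof -
  let ?Z = "{x \<in> supported_on {..<n}. \<not> PAR n x}"
  let ?f = "\<lambda>x. x(0 := \<not> x (0::nat))"
  have flip: "PAR n (?f x) \<longleftrightarrow> \<not> PAR n x" for x using PAR_flip[of 0 n x] assms by simp
  have supp: "?f x \<in> supported_on {..<n}" if "x \<in> supported_on {..<n}" for x
    using that assms by (auto simp: supported_on_def)
  have "bij_betw ?f (PAR_ones n) ?Z"
    by (rule bij_betw_byWitness[where f' = ?f]) (use flip supp in \<open>auto simp: PAR_ones_def\<close>)
  then have "card (PAR_ones n) = card ?Z" by (rule bij_betw_same_card)
  moreover have "card (PAR_ones n \<union> ?Z) = card (PAR_ones n) + card ?Z"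
    by (intro card_Un_disjoint) (auto simp: PAR_ones_def)
  moreover have "PAR_ones n \<union> ?Z = supported_on {..<n}" by (auto simp: PAR_ones_def)
  ultimately show ?thesis by (simp add: card_supported_on)
qed

section \<open>Critical clauses\<close>

definition clause_inputs :: "var clause \<Rightarrow> nat set" where
  "clause_inputs C = {i. X i \<in> lit_var ` C}"

lemma card_clause_inputs: "finite C \<Longrightarrow> card (clause_inputs C) \<le> card C"
proof -
  assume C: "finite C"
  have "card (clause_inputs C) \<le> card (lit_var ` C)"
    using C by (intro card_inj_on_le[of X]) (auto simp: clause_inputs_def inj_on_def)
  also have "\<dots> \<le> card C" using C by (rule card_image_le)
  finally show ?thesis .
qed

lemma clause_inputs_subset: "is_cnf n s F \<Longrightarrow> C \<in> F \<Longrightarrow> clause_inputs C \<subseteq> {..<n}"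
  by (fastforce simp: is_cnf_def vars_def clause_inputs_def)

definition critical :: "var clause \<Rightarrow> nat \<Rightarrow> (nat \<Rightarrow> bool) \<Rightarrow> (nat \<Rightarrow> bool) \<Rightarrow> bool" where
  "critical C i x y \<longleftrightarrow> clause_sat (case_var x y) C \<and> \<not> clause_sat (case_var (x(i := \<not> x i)) y) C"

lemma critical_mem: "critical C i x y \<Longrightarrow> i \<in> clause_inputs C"
proof (rule ccontr)
  assume *: "critical C i x y" "i \<notin> clause_inputs C"
  have "clause_sat (case_var x y) C = clause_sat (case_var (x(i := \<not> x i)) y) C"
    unfolding clause_sat_def
  proof (intro bex_cong refl)
    fix l assume "l \<in> C"
    then have "lit_var l \<noteq> X i" using *(2) by (auto simp: clause_inputs_def image_iff)
    then show "lit_sat (case_var x y) l = lit_sat (case_var (x(i := \<not> x i)) y) l"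
      by (cases l; cases "lit_var l") auto
  qed
  then show False using *(1) by (simp add: critical_def)
qed

text \<open>A solution with a critical clause falsifies all other literals of that clause, so the clause
  prescribes the bits of the solution.\<close>

lemma critical_values:
  assumes "critical C i x y" "j \<in> clause_inputs C"
  shows "x j \<longleftrightarrow> (if j = i then Pos (X i) \<in> C else Neg (X j) \<in> C)"
proof -
  have un: "\<not> lit_sat (case_var (x(i := \<not> x i)) y) l" if "l \<in> C" for l
    using assms(1) that unfolding critical_def clause_sat_def by blast
  obtain l where "l \<in> C" "lit_var l = X j"
    using assms(2) by (auto simp: clause_inputs_def)
  then have "Pos (X j) \<in> C \<or> Neg (X j) \<in> C" by (cases l) auto
  then show ?thesis
    using un[of "Pos (X j)"] un[of "Neg (X j)"] by auto
qed

text \<open>Otherwise \<open>z\<close> agrees with the flipped \<open>x\<close> on all inputs of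
  \<open>C\<close>. As the guesses are shared, a literal of \<open>C\<close> true under
  \<open>z\<close> would be true at the flipped point. This is the isolation that
  \<open>kraft_isolated\<close> requires.\<close>

lemma critical_isolated:
  assumes "critical C i x y" "clause_sat (case_var z y) C"
    and "\<And>j. j \<in> clause_inputs C - {i} \<Longrightarrow> z j = x j"
  shows "z i = x i"
proof (rule ccontr)
  assume "z i \<noteq> x i"
  obtain l where l: "l \<in> C" "lit_sat (case_var z y) l"
    using assms(2) by (auto simp: clause_sat_def)
  have "lit_sat (case_var (x(i := \<not> x i)) y) l"
  proof (cases "lit_var l")
    case (X j)
    then have "j \<in> clause_inputs C" using l unfolding clause_inputs_def by (metis imageI mem_Collect_eq)
    then have "z j = (x(i := \<not> x i)) j" using assms(3)[of j] \<open>z i \<noteq> x i\<close> by auto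
    then show ?thesis using l(2) X by (cases l) auto
  next
    case (Y j)
    then show ?thesis using l(2) by (cases l) auto
  qed
  then show False using assms(1) l(1) by (auto simp: critical_def clause_sat_def)
qed

text \<open>No guesses are accepted at a point of even parity, so flipping an input of
  \<open>x\<close> while keeping \<open>y x\<close> must falsify a clause.\<close>

lemma critical_clauses_exist:
  assumes "encodes n s F (PAR n)"
  obtains y C where
    "\<And>x. x \<in> PAR_ones n \<Longrightarrow> y x \<in> supported_on {..<s} \<and> cnf_sat (case_var x (y x)) F"
    "\<And>x i. x \<in> PAR_ones n \<Longrightarrow> i < n \<Longrightarrow> C x i \<in> F \<and> critical (C x i) i x (y x)"
proof -
  have cnf: "is_cnf n s F" and enc: "\<And>x. PAR n x \<longleftrightarrow> (\<exists>y. cnf_sat (case_var x y) F)"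
    using assms by (auto simp: encodes_def)
  have "\<exists>y. y \<in> supported_on {..<s} \<and> cnf_sat (case_var x y) F" if x: "x \<in> PAR_ones n" for x
  proof -
    obtain y where y: "cnf_sat (case_var x y) F" using enc[of x] x by (auto simp: PAR_ones_def)
    \<comment> \<open>Guesses from index \<open>s\<close> on do not occur in \<open>F\<close>;
      clearing them leaves at most \<open>2 ^ s\<close> possible guesses.\<close>
    let ?y = "\<lambda>j. y j \<and> j < s"
    have "lit_sat (case_var x ?y) l = lit_sat (case_var x y) l" if "C \<in> F" "l \<in> C" for C l
    proof -
      have "lit_var l \<in> vars n s" using cnf that by (auto simp: is_cnf_def)
      then show ?thesis by (cases l) (auto simp: vars_def)
    qed
    then have "cnf_sat (case_var x ?y) F"
      using y unfolding cnf_sat_def clause_sat_def by blast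
    then show ?thesis by (intro exI[of _ ?y]) (auto simp: supported_on_def)
  qed
  then obtain y where y: "\<And>x. x \<in> PAR_ones n \<Longrightarrow> y x \<in> supported_on {..<s} \<and> cnf_sat (case_var x (y x)) F"
    by metis
  have "\<exists>C. C \<in> F \<and> critical C i x (y x)" if x: "x \<in> PAR_ones n" "i < n" for x i
  proof -
    have "\<not> PAR n (x(i := \<not> x i))" using PAR_flip[of i n x] x by (simp add: PAR_ones_def)
    then have "\<not> cnf_sat (case_var (x(i := \<not> x i)) (y x)) F" using enc by blast
    then show ?thesis using y[OF x(1)] unfolding cnf_sat_def critical_def by blast
  qed
  then obtain C where "\<And>x i. x \<in> PAR_ones n \<Longrightarrow> i < n \<Longrightarrow> C x i \<in> F \<and> critical (C x i) i x (y x)"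
    by metis
  then show ?thesis using that y by blast
qed

section \<open>Average savings, width and size\<close>

text \<open>The solutions with the same guesses satisfy Kraft's inequality, so the
  \<open>2 ^ s\<close> fibres of \<open>y\<close> give a total of at most
  \<open>2 ^ (s + n)\<close>, which is \<open>2 powr (s + 1)\<close> per solution. Convexity turns
  this into a bound on the average exponent.\<close>

lemma sum_savings_le:
  assumes cnf: "is_cnf n s F" and n: "n \<ge> 1"
    and y: "\<And>x. x \<in> PAR_ones n \<Longrightarrow> y x \<in> supported_on {..<s} \<and> cnf_sat (case_var x (y x)) F"
    and C: "\<And>x i. x \<in> PAR_ones n \<Longrightarrow> i < n \<Longrightarrow> C x i \<in> F \<and> critical (C x i) i x (y x)"
  shows "(\<Sum>x\<in>PAR_ones n. \<Sum>i<n. 1 / real (card (clause_inputs (C x i)))) \<le> (real s + 1) * real (card (PAR_ones n))"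
proof -
  let ?P = "PAR_ones n" and ?T = "supported_on {..<s}"
  let ?sav = "\<lambda>x. \<Sum>i<n. 1 / real (card (clause_inputs (C x i)))"
  have "(\<Sum>x\<in>{x\<in>?P. y x = t}. 2 powr ?sav x) \<le> 2 ^ card {..<n}" for t
  proof (rule kraft_isolated)
    fix x z assume *: "x \<in> {x\<in>?P. y x = t}" "z \<in> {x\<in>?P. y x = t}" "\<And>i. i \<in> {..<n} \<Longrightarrow> x i = z i"
    then have "x i = z i" for i
      by (cases "i < n") (auto simp: PAR_ones_def supported_on_def)
    then show "x = z" by blast
  next
    fix x i assume "x \<in> {x\<in>?P. y x = t}" "i \<in> {..<n}"
    then show "i \<in> clause_inputs (C x i) \<and> clause_inputs (C x i) \<subseteq> {..<n}"
      using C[of x i] critical_mem clause_inputs_subset[OF cnf] by blast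
  next
    fix x z i assume *: "x \<in> {x\<in>?P. y x = t}" "z \<in> {x\<in>?P. y x = t}" "i \<in> {..<n}"
      "\<And>j. j \<in> clause_inputs (C x i) - {i} \<Longrightarrow> z j = x j"
    have "C x i \<in> F" "critical (C x i) i x t" using C[of x i] * by auto
    moreover have "cnf_sat (case_var z t) F" using y[of z] * by auto
    ultimately show "z i = x i"
      using critical_isolated[of "C x i" i x t z] * by (auto simp: cnf_sat_def)
  qed auto
  then have "(\<Sum>t\<in>?T. \<Sum>x\<in>{x\<in>?P. y x = t}. 2 powr ?sav x) \<le> (\<Sum>t\<in>?T. 2 ^ n)"
    by (intro sum_mono) simp
  also have "\<dots> = 2 ^ s * 2 ^ n" by (simp add: card_supported_on)
  also have "(\<Sum>t\<in>?T. \<Sum>x\<in>{x\<in>?P. y x = t}. 2 powr ?sav x) = (\<Sum>x\<in>?P. 2 powr ?sav x)"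
    using y by (intro sum.group) auto
  also have "(2::real) ^ n = 2 * real (card ?P)"
    using card_PAR_ones[OF n] by (metis of_nat_mult of_nat_numeral of_nat_power)
  finally have "(\<Sum>x\<in>?P. 2 powr ?sav x) \<le> 2 powr (real s + 1) * real (card ?P)"
    by (simp add: powr_add powr_realpow)
  \<comment> \<open>The constant term of the tangent at \<open>s + 1\<close> already exhausts the
    upper bound, so the linear term is nonpositive.\<close>
  moreover have "(\<Sum>x\<in>?P. 2 powr ?sav x)
      \<ge> 2 powr (real s + 1) * (real (card ?P) + ln 2 * ((\<Sum>x\<in>?P. ?sav x) - (real s + 1) * real (card ?P)))"
    by (rule sum_powr_ge_tangent)
  ultimately have "2 powr (real s + 1) * (real (card ?P) + ln 2 * ((\<Sum>x\<in>?P. ?sav x) - (real s + 1) * real (card ?P)))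
      \<le> 2 powr (real s + 1) * real (card ?P)" by linarith
  then have "ln 2 * ((\<Sum>x\<in>?P. ?sav x) - (real s + 1) * real (card ?P)) \<le> 0"
    by simp
  then show ?thesis by (simp add: mult_le_0_iff)
qed

lemma encodes_nonempty:
  assumes "encodes n s F (PAR n)" "n \<ge> 1"
  shows "finite F" "F \<noteq> {}"
proof -
  show "finite F" using assms by (simp add: encodes_def is_cnf_def)
  show "F \<noteq> {}"
  proof
    assume "F = {}"
    then have "PAR n x" for x using assms(1) by (auto simp: encodes_def cnf_sat_def)
    then show False using PAR_flip[of 0 n] assms(2) by auto
  qed
qed

text \<open>A critical clause has at most \<open>max_width F\<close> inputs, so each of the
  \<open>n\<close> bits saves at least \<open>1 / max_width F\<close>, while the average total
  saving is at most \<open>s + 1\<close>.\<close>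

lemma PAR_width:
  assumes enc: "encodes n s F (PAR n)" and n: "n \<ge> 1"
  shows "real (max_width F) \<ge> real n / (real s + 1)"
proof -
  have cnf: "is_cnf n s F" using enc by (simp add: encodes_def)
  obtain y C where y: "\<And>x. x \<in> PAR_ones n \<Longrightarrow> y x \<in> supported_on {..<s} \<and> cnf_sat (case_var x (y x)) F"
    and C: "\<And>x i. x \<in> PAR_ones n \<Longrightarrow> i < n \<Longrightarrow> C x i \<in> F \<and> critical (C x i) i x (y x)"
    using critical_clauses_exist[OF enc] by blast
  let ?P = "PAR_ones n" and ?k = "real (max_width F)"
  have P: "real (card ?P) > 0" using card_PAR_ones[OF n] by (simp add: card_gt_0_iff) (metis card.empty mult_0_right power_not_zero zero_neq_numeral)
  \<comment> \<open>The lower bound 1 rules out the default value \<open>1 / 0 = 0\<close>.\<close>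
  have w: "1 \<le> card (clause_inputs (C x i)) \<and> card (clause_inputs (C x i)) \<le> max_width F"
    if "x \<in> ?P" "i < n" for x i
  proof -
    have "C x i \<in> F" "i \<in> clause_inputs (C x i)" using C[OF that] critical_mem by blast+
    moreover have "finite (clause_inputs (C x i))"
      using clause_inputs_subset[OF cnf] C[OF that] finite_subset by blast
    moreover have "finite (C x i)" using cnf C[OF that] by (auto simp: is_cnf_def)
    moreover have "card (C x i) \<le> max_width F"
      unfolding max_width_def using C[OF that] encodes_nonempty[OF enc n]
      by (intro Max_ge) (auto simp: clause_width_def)
    ultimately show ?thesis
      using card_clause_inputs[of "C x i"] by (metis One_nat_def Suc_leI card_gt_0_iff empty_iff order.trans)
  qed
  obtain x0 where "x0 \<in> ?P" using P by (metis card.empty ex_in_conv of_nat_0 less_irrefl)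
  then have k: "?k \<ge> 1" using w[of x0 0] n by simp
  have "(\<Sum>x\<in>?P. \<Sum>i<n. 1 / ?k) \<le> (\<Sum>x\<in>?P. \<Sum>i<n. 1 / real (card (clause_inputs (C x i))))"
    using w by (intro sum_mono divide_left_mono) (auto, fastforce)
  also have "\<dots> \<le> (real s + 1) * real (card ?P)"
    by (rule sum_savings_le[OF cnf n y C])
  finally have "real (card ?P) * (real n / ?k) \<le> real (card ?P) * (real s + 1)" by (simp add: mult.commute)
  then have "real n / ?k \<le> real s + 1" using P by (simp only: mult_le_cancel_left_pos)
  then show ?thesis using k by (simp add: field_simps)
qed

text \<open>In terms of \<open>t = 1 / w\<close>, the right-hand side is the tangent at \<open>1 / r\<close> of the convex
  function \<open>t * 2 powr (1 / t)\<close>.\<close>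

lemma powr_div_ge:
  fixes w r :: real
  assumes "w > 0"
  shows "2 powr w / w \<ge> 2 powr r * (ln 2 + (1 - r * ln 2) / w)"
proof -
  have "2 powr w = 2 powr r * exp (ln 2 * (w - r))"
    by (simp add: powr_def exp_add[symmetric] algebra_simps)
  also have "\<dots> \<ge> 2 powr r * (1 + ln 2 * (w - r))"
    using exp_ge_add_one_self[of "ln 2 * (w - r)"] by simp
  finally have "2 powr w / w \<ge> 2 powr r * (1 + ln 2 * (w - r)) / w"
    using assms by (simp add: divide_right_mono)
  moreover have "2 powr r * (1 + ln 2 * (w - r)) / w = 2 powr r * (ln 2 + (1 - r * ln 2) / w)"
    using assms by (simp add: field_simps)
  ultimately show ?thesis by simp
qed

text \<open>The weight \<open>2 powr w / w\<close> is chosen so that every clause receives at most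
  \<open>2 ^ n\<close>: by \<open>critical_values\<close>, a clause with \<open>w\<close> inputs is
  critical for at most \<open>w * 2 ^ (n - w)\<close> pairs.\<close>

lemma sum_critical_le:
  assumes cnf: "is_cnf n s F"
    and C: "\<And>x i. x \<in> PAR_ones n \<Longrightarrow> i < n \<Longrightarrow> C x i \<in> F \<and> critical (C x i) i x (y x)"
  shows "(\<Sum>x\<in>PAR_ones n. \<Sum>i<n. 2 powr real (card (clause_inputs (C x i))) / real (card (clause_inputs (C x i))))
    \<le> real (card F) * 2 ^ n"
proof -
  let ?Q = "PAR_ones n \<times> {..<n}"
  define g where "g K = 2 powr real (card (clause_inputs K)) / real (card (clause_inputs K))" for K
  have fin: "finite F" using cnf by (simp add: is_cnf_def)
  have fib: "(\<Sum>q\<in>{q\<in>?Q. case_prod C q = K}. g (case_prod C q)) \<le> 2 ^ n" if K: "K \<in> F" for K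
  proof -
    let ?D = "clause_inputs K"
    note D = clause_inputs_subset[OF cnf K]
    have fD: "finite ?D" using D finite_subset by blast
    have Dn: "card ?D \<le> n" using card_mono[OF _ D] by simp
    \<comment> \<open>The bits that a solution must have if \<open>K\<close> is critical for
      \<open>i\<close>: the literal of \<open>K\<close> on input \<open>i\<close> is true, those on
      other inputs are false.\<close>
    define p where "p i j \<longleftrightarrow> (if j = i then Pos (X i) \<in> K else Neg (X j) \<in> K)" for i j
    have "{q\<in>?Q. case_prod C q = K} \<subseteq> (\<Union>i\<in>?D. {x \<in> supported_on {..<n}. \<forall>j\<in>?D. x j = p i j} \<times> {i})"
    proof
      fix q assume "q \<in> {q\<in>?Q. case_prod C q = K}"
      then obtain x i where q: "q = (x, i)" "case_prod C q = K" "x \<in> PAR_ones n" "i \<in> {..<n}"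
        by blast
      then have "critical K i x (y x)" using C[of x i] by simp
      then have "i \<in> ?D" "\<forall>j\<in>?D. x j = p i j"
        using critical_mem critical_values unfolding p_def by blast+
      then show "q \<in> (\<Union>i\<in>?D. {x \<in> supported_on {..<n}. \<forall>j\<in>?D. x j = p i j} \<times> {i})"
        using q by (simp add: PAR_ones_def)
    qed
    then have "card {q\<in>?Q. case_prod C q = K}
        \<le> card (\<Union>i\<in>?D. {x \<in> supported_on {..<n}. \<forall>j\<in>?D. x j = p i j} \<times> {i})"
      using fD by (intro card_mono) auto
    also have "\<dots> \<le> (\<Sum>i\<in>?D. card ({x \<in> supported_on {..<n}. \<forall>j\<in>?D. x j = p i j} \<times> {i}))"
      by (rule card_UN_le[OF fD])
    also have "\<dots> \<le> (\<Sum>i\<in>?D. 2 ^ (n - card ?D))"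
      using card_supported_on_prescribed[OF _ D] by (intro sum_mono) (simp add: card_cartesian_product)
    finally have "card {q\<in>?Q. case_prod C q = K} \<le> card ?D * 2 ^ (n - card ?D)" by simp
    then have "real (card {q\<in>?Q. case_prod C q = K}) \<le> real (card ?D * 2 ^ (n - card ?D))"
      by (rule of_nat_mono)
    then have "real (card {q\<in>?Q. case_prod C q = K}) \<le> real (card ?D) * 2 ^ (n - card ?D)"
      by (simp only: of_nat_mult of_nat_power of_nat_numeral)
    then have "real (card {q\<in>?Q. case_prod C q = K}) * g K \<le> real (card ?D) * 2 ^ (n - card ?D) * g K"
      by (intro mult_right_mono) (simp_all add: g_def)
    also have "\<dots> \<le> 2 ^ (n - card ?D) * 2 ^ card ?D"
      by (cases "card ?D = 0") (simp_all add: g_def powr_realpow)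
    also have "\<dots> = 2 ^ n" using Dn by (simp add: power_add[symmetric])
    finally show ?thesis by simp
  qed
  have "(\<Sum>x\<in>PAR_ones n. \<Sum>i<n. g (C x i)) = (\<Sum>q\<in>?Q. g (case_prod C q))"
    by (simp add: sum.cartesian_product case_prod_unfold)
  also have "\<dots> = (\<Sum>K\<in>F. \<Sum>q\<in>{q\<in>?Q. case_prod C q = K}. g (case_prod C q))"
    using fin C by (intro sum.group[symmetric]) auto
  also have "\<dots> \<le> (\<Sum>K\<in>F. 2 ^ n)" by (intro sum_mono fib)
  finally show ?thesis by (simp add: g_def)
qed

text \<open>The weights in \<open>sum_critical_le\<close> are bounded below by
  \<open>powr_div_ge\<close> with \<open>r = n / (s + 1)\<close>. The hypothesis on \<open>s\<close>
  says \<open>r * ln 2 >= 1\<close>, so \<open>1 / w\<close> has a nonpositive coefficient and the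
  upper bound on the savings can be inserted.\<close>

lemma PAR_size_few_guesses:
  assumes enc: "encodes n s F (PAR n)" and n: "n \<ge> 1" and s: "real s + 1 \<le> ln 2 * real n"
  shows "real (card F) \<ge> (real s + 1) / 2 * 2 powr (real n / (real s + 1))"
proof -
  have cnf: "is_cnf n s F" using enc by (simp add: encodes_def)
  obtain y C where y: "\<And>x. x \<in> PAR_ones n \<Longrightarrow> y x \<in> supported_on {..<s} \<and> cnf_sat (case_var x (y x)) F"
    and C: "\<And>x i. x \<in> PAR_ones n \<Longrightarrow> i < n \<Longrightarrow> C x i \<in> F \<and> critical (C x i) i x (y x)"
    using critical_clauses_exist[OF enc] by blast
  let ?P = "PAR_ones n"
  let ?w = "\<lambda>x i. real (card (clause_inputs (C x i)))"
  define r where "r = real n / (real s + 1)"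
  define N where "N = real (card ?P)"
  have N: "2 ^ n = 2 * N"
    unfolding N_def using card_PAR_ones[OF n] by (metis of_nat_mult of_nat_numeral of_nat_power)
  then have N0: "N > 0" by (metis zero_less_mult_pos zero_less_numeral zero_less_power)
  have r: "1 - r * ln 2 \<le> 0" using s by (simp add: r_def field_simps)
  have rs: "r * (real s + 1) = real n" by (simp add: r_def)
  have w: "?w x i > 0" if "x \<in> ?P" "i < n" for x i
  proof -
    have "i \<in> clause_inputs (C x i)" using C[OF that] critical_mem by blast
    moreover have "finite (clause_inputs (C x i))"
      using clause_inputs_subset[OF cnf] C[OF that] finite_subset by blast
    ultimately show ?thesis by (auto simp: card_gt_0_iff)
  qed
  \<comment> \<open>For the extreme savings \<open>(s + 1) * N\<close> the terms with
    \<open>ln 2\<close> cancel.\<close>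
  have "2 powr r * N * (real s + 1) = 2 powr r * (N * real n * ln 2 + (1 - r * ln 2) * ((real s + 1) * N))"
    unfolding rs[symmetric] by (simp add: algebra_simps)
  also have "\<dots> \<le> 2 powr r * (N * real n * ln 2 + (1 - r * ln 2) * (\<Sum>x\<in>?P. \<Sum>i<n. 1 / ?w x i))"
    using sum_savings_le[OF cnf n y C] r
    by (intro mult_left_mono add_left_mono mult_left_mono_neg) (simp_all add: N_def)
  also have "\<dots> = (\<Sum>x\<in>?P. \<Sum>i<n. 2 powr r * (ln 2 + (1 - r * ln 2) / ?w x i))"
    by (simp add: N_def sum.distrib sum_distrib_left distrib_left)
  also have "\<dots> \<le> (\<Sum>x\<in>?P. \<Sum>i<n. 2 powr ?w x i / ?w x i)"
    using w by (intro sum_mono powr_div_ge) auto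
  also have "\<dots> \<le> real (card F) * 2 ^ n" by (rule sum_critical_le[OF cnf C])
  finally have "N * (2 powr r * (real s + 1)) \<le> N * (2 * real (card F))" by (simp add: N mult_ac)
  then have "2 powr r * (real s + 1) \<le> 2 * real (card F)" using N0 by simp
  then show ?thesis by (simp add: r_def field_simps)
qed

text \<open>With many guesses the exponent is at most \<open>1 / ln 2\<close>, so the power is at
  most 3, and \<open>s <= n * card F\<close> makes \<open>(s + 1) / n\<close> at most
  \<open>2 * card F\<close>. The constant \<open>1 / 8\<close> absorbs the resulting factor
  6.\<close>

lemma PAR_size:
  assumes enc: "encodes n s F (PAR n)" and n: "n \<ge> 1" and s: "s \<le> n * card F"
  shows "real (card F) \<ge> 1 / 8 * ((real s + 1) / real n) * 2 powr (real n / (real s + 1))"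
proof (cases "real s + 1 \<le> ln 2 * real n")
  case True
  have "(real s + 1) / real n \<le> (real s + 1) / 1"
    using n by (intro divide_left_mono) auto
  then have "(real s + 1) / real n \<le> real s + 1" by simp
  moreover have "0 \<le> real s" by simp
  ultimately have "1 / 8 * ((real s + 1) / real n) \<le> (real s + 1) / 2" by argo
  then have "1 / 8 * ((real s + 1) / real n) * 2 powr (real n / (real s + 1))
      \<le> (real s + 1) / 2 * 2 powr (real n / (real s + 1))"
    by (intro mult_right_mono) auto
  then show ?thesis using PAR_size_few_guesses[OF enc n True] by linarith
next
  case False
  have "ln 2 * (real n / (real s + 1)) \<le> 1" using False by (simp add: field_simps)
  then have "exp (ln 2 * (real n / (real s + 1))) \<le> exp 1" by (subst exp_le_cancel_iff)
  then have "exp (ln 2 * (real n / (real s + 1))) \<le> 3" using exp_le by linarith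
  then have e: "2 powr (real n / (real s + 1)) \<le> 3"
    by (simp add: powr_def mult.commute)
  have "card F \<ge> 1"
    using encodes_nonempty[OF enc n] by (simp add: Suc_leI card_gt_0_iff)
  then have "n * card F \<ge> 1" using n by simp
  then have "s + 1 \<le> 2 * (n * card F)" using s by linarith
  then have "real (s + 1) \<le> real (2 * (n * card F))" by (rule of_nat_mono)
  then have "real s + 1 \<le> 2 * real (card F) * real n" by (simp add: algebra_simps)
  then have "(real s + 1) / real n \<le> 2 * real (card F)"
    using n by (simp add: divide_le_eq)
  then have "1 / 8 * ((real s + 1) / real n) * 2 powr (real n / (real s + 1))
      \<le> 1 / 8 * (2 * real (card F)) * 3"
    using e by (intro mult_mono) auto
  then show ?thesis by simp
qed

section \<open>Clauses saved by restricting an input\<close>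

fun neg :: "'v literal \<Rightarrow> 'v literal" where
  "neg (Pos v) = Neg v"
| "neg (Neg v) = Pos v"

lemma neg_neg [simp]: "neg (neg l) = l"
  by (cases l) auto

lemma neg_eq_iff [simp]: "neg l = neg l' \<longleftrightarrow> l = l'"
  by (cases l; cases l') auto

lemma neg_neq [simp]: "neg l \<noteq> l" "l \<noteq> neg l"
  by (cases l; simp)+

lemma lit_var_neg [simp]: "lit_var (neg l) = lit_var l"
  by (cases l) auto

lemma lit_sat_neg [simp]: "lit_sat a (neg l) \<longleftrightarrow> \<not> lit_sat a l"
  by (cases l) auto

lemma lit_var_eq_iff: "lit_var l = lit_var l' \<longleftrightarrow> l = l' \<or> l = neg l'"
  by (cases l; cases l') auto

lemma lit_sat_cong: "a (lit_var l) = a' (lit_var l) \<Longrightarrow> lit_sat a l = lit_sat a' l"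
  by (cases l) auto

definition set_true :: "'v literal set \<Rightarrow> ('v \<Rightarrow> bool) \<Rightarrow> 'v \<Rightarrow> bool" where
  "set_true L a = (\<lambda>v. if Pos v \<in> L then True else if Neg v \<in> L then False else a v)"

definition consistent :: "'v literal set \<Rightarrow> bool" where
  "consistent L \<longleftrightarrow> (\<forall>l\<in>L. neg l \<notin> L)"

definition restrict_cnf :: "'v literal set \<Rightarrow> 'v cnf \<Rightarrow> 'v cnf" where
  "restrict_cnf L F = (\<lambda>C. C - neg ` L) ` {C\<in>F. C \<inter> L = {}}"

lemma set_true_outside: "v \<notin> lit_var ` L \<Longrightarrow> set_true L a v = a v"
  unfolding set_true_def by force

lemma consistent_singleton [simp]: "consistent {l}"
  by (simp add: consistent_def)

lemma lit_sat_set_true: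
  assumes "consistent L"
  shows "lit_sat (set_true L a) l \<longleftrightarrow> l \<in> L \<or> (neg l \<notin> L \<and> lit_sat a l)"
  using assms unfolding consistent_def by (cases l) (force simp: set_true_def)+

lemma set_true_id: "(\<And>l. l \<in> L \<Longrightarrow> lit_sat a l) \<Longrightarrow> set_true L a = a"
  by (rule ext) (force simp: set_true_def)

lemma cnf_sat_restrict:
  assumes "consistent L"
  shows "cnf_sat a (restrict_cnf L F) \<longleftrightarrow> cnf_sat (set_true L a) F"
proof -
  have "clause_sat (set_true L a) C \<longleftrightarrow> C \<inter> L \<noteq> {} \<or> clause_sat a (C - neg ` L)" for C
  proof -
    have "l \<in> neg ` L \<longleftrightarrow> neg l \<in> L" for l
      by (metis imageE imageI neg_neg)
    then show ?thesis
      unfolding clause_sat_def lit_sat_set_true[OF assms] by blast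
  qed
  then show ?thesis
    unfolding cnf_sat_def restrict_cnf_def ball_simps image_iff by blast
qed

text \<open>Only an inequality, as shortened clauses may coincide.\<close>

lemma card_restrict:
  assumes "finite F"
  shows "card (restrict_cnf L F) + card {C\<in>F. C \<inter> L \<noteq> {}} \<le> card F"
proof -
  have "card (restrict_cnf L F) \<le> card {C\<in>F. C \<inter> L = {}}"
    unfolding restrict_cnf_def by (rule card_image_le) (use assms in auto)
  moreover have "card {C\<in>F. C \<inter> L = {}} + card {C\<in>F. C \<inter> L \<noteq> {}} = card F"
    by (subst card_Un_disjoint[symmetric]) (use assms in \<open>auto intro: arg_cong[where f=card]\<close>)
  ultimately show ?thesis by linarith
qed

section \<open>Parity encodings up to sign\<close>

definition proj :: "'v set \<Rightarrow> 'v cnf \<Rightarrow> ('v \<Rightarrow> bool) \<Rightarrow> bool" where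
  "proj I F a \<longleftrightarrow> (\<exists>a'. (\<forall>v\<in>I. a' v = a v) \<and> cnf_sat a' F)"

text \<open>For finite \<open>I\<close> this says that \<open>F\<close> encodes the parity of the variables in \<open>I\<close> or its
  negation, all other variables being guesses. Not fixing the sign keeps the class closed under
  restricting an input.\<close>

definition par_enc :: "'v set \<Rightarrow> 'v cnf \<Rightarrow> bool" where
  "par_enc I F \<longleftrightarrow> finite F \<and> (\<forall>a. \<forall>v\<in>I. proj I F (a(v := \<not> a v)) \<longleftrightarrow> \<not> proj I F a)"

lemma par_enc_flip:
  assumes "par_enc I F" "v \<in> I" "cnf_sat a F"
  shows "\<not> cnf_sat (a(v := \<not> a v)) F"
proof -
  have "proj I F a" using assms(3) unfolding proj_def by blast
  then have "\<not> proj I F (a(v := \<not> a v))" using assms(1,2) unfolding par_enc_def by simp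
  then show ?thesis unfolding proj_def by metis
qed

text \<open>One of \<open>a\<close> and its flip at \<open>v\<close> has the accepted
  parity.\<close>

lemma par_enc_solution:
  assumes "par_enc I F" "v \<in> I"
  obtains a' where "cnf_sat a' F" "\<And>u. u \<in> I - {v} \<Longrightarrow> a' u = a u"
proof -
  have "proj I F a \<or> proj I F (a(v := \<not> a v))"
    using assms unfolding par_enc_def by blast
  then show ?thesis
    unfolding proj_def using that by (metis DiffE fun_upd_other singletonI)
qed

lemma par_enc_cong:
  assumes "par_enc I F" "finite G" "\<And>a. proj I G a \<longleftrightarrow> proj I F a"
  shows "par_enc I G"
  using assms unfolding par_enc_def by auto

text \<open>Besides the input literal \<open>l\<close>, guess literals that hold in every solution
  with \<open>l\<close> may be fixed for free, which removes further clauses. The projection of the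
  result at \<open>a\<close> is that of \<open>F\<close> at \<open>a\<close> with \<open>l\<close>
  made true.\<close>

lemma par_enc_restrict:
  assumes enc: "par_enc I F" and L: "consistent L" "l \<in> L" "lit_var l \<in> I"
    and guess: "\<And>l'. l' \<in> L \<Longrightarrow> l' \<noteq> l \<Longrightarrow> lit_var l' \<notin> I"
    and forced: "\<And>a l'. cnf_sat a F \<Longrightarrow> lit_sat a l \<Longrightarrow> l' \<in> L \<Longrightarrow> lit_sat a l'"
  shows "par_enc (I - {lit_var l}) (restrict_cnf L F)"
proof -
  let ?x = "lit_var l"
  have eq: "proj (I - {?x}) (restrict_cnf L F) a \<longleftrightarrow> proj I F (set_true {l} a)" for a
  proof
    assume "proj (I - {?x}) (restrict_cnf L F) a"
    then obtain a' where a': "\<forall>v\<in>I - {?x}. a' v = a v" "cnf_sat (set_true L a') F"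
      unfolding proj_def cnf_sat_restrict[OF L(1)] by blast
    have "set_true L a' v = set_true {l} a v" if v: "v \<in> I" for v
    proof (cases "v = ?x")
      case True
      have "lit_sat (set_true L a') l" "lit_sat (set_true {l} a) l"
        using L by (simp_all add: lit_sat_set_true)
      then show ?thesis using True by (cases l) auto
    next
      case False
      have "v \<notin> lit_var ` L" using guess v False by auto
      then show ?thesis using False v a'(1) by (simp add: set_true_outside)
    qed
    then show "proj I F (set_true {l} a)"
      unfolding proj_def using a'(2) by blast
  next
    assume "proj I F (set_true {l} a)"
    then obtain a' where a': "\<forall>v\<in>I. a' v = set_true {l} a v" "cnf_sat a' F"
      unfolding proj_def by blast
    have "lit_sat (set_true {l} a) l" by (simp add: lit_sat_set_true)
    then have "lit_sat a' l" using a'(1) L(3) lit_sat_cong by metis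
    then have "set_true L a' = a'"
      using forced[OF a'(2)] by (intro set_true_id) auto
    then show "proj (I - {?x}) (restrict_cnf L F) a"
      unfolding proj_def cnf_sat_restrict[OF L(1)]
      using a' by (intro exI[of _ a']) (auto simp: set_true_outside)
  qed
  have "set_true {l} (a(v := \<not> a v)) = (set_true {l} a)(v := \<not> set_true {l} a v)" if "v \<noteq> ?x" for a v
    using that by (cases l) (auto simp: set_true_def fun_eq_iff)
  then show ?thesis
    using enc unfolding par_enc_def eq by (auto simp: restrict_cnf_def)
qed

section \<open>Encodings with the fewest clauses\<close>

text \<open>The competitors \<open>G\<close> may encode either sign of the parity and use any
  guesses.\<close>

definition min_par_enc :: "'v set \<Rightarrow> 'v cnf \<Rightarrow> bool" where
  "min_par_enc I F \<longleftrightarrow> par_enc I F \<and> (\<forall>G. par_enc I G \<longrightarrow> card F \<le> card G)"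

definition occs :: "'v literal \<Rightarrow> 'v cnf \<Rightarrow> 'v clause set" where
  "occs l F = {C\<in>F. l \<in> C}"

lemma finite_occs [simp]: "finite F \<Longrightarrow> finite (occs l F)"
  by (simp add: occs_def)

lemma min_par_encD:
  assumes "min_par_enc I F"
  shows "par_enc I F" "finite F"
  using assms by (auto simp: min_par_enc_def par_enc_def)

lemma not_min_par_enc:
  assumes "min_par_enc I F" "finite G" "card G < card F" "\<And>a. proj I G a \<longleftrightarrow> proj I F a"
  shows False
  using assms par_enc_cong[of I F G] unfolding min_par_enc_def by fastforce

lemma exists_min_par_enc:
  assumes "par_enc I F"
  obtains G where "min_par_enc I G" "card G \<le> card F"
  using exists_least_iff[of "\<lambda>k. \<exists>G. par_enc I G \<and> card G = k"] assms
  unfolding min_par_enc_def by (metis linorder_not_less)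

lemma min_par_enc_no_tautology:
  assumes F: "min_par_enc I F" and C: "C \<in> F" "l \<in> C"
  shows "neg l \<notin> C"
proof
  assume n: "neg l \<in> C"
  have "clause_sat a C" for a
    using C n unfolding clause_sat_def by (metis lit_sat_neg)
  then have "cnf_sat a (F - {C}) \<longleftrightarrow> cnf_sat a F" for a
    by (auto simp: cnf_sat_def)
  then have "proj I (F - {C}) a \<longleftrightarrow> proj I F a" for a
    by (simp add: proj_def)
  then show False
    using not_min_par_enc[OF F, of "F - {C}"] min_par_encD[OF F] C
    by (metis card_Diff1_less finite_Diff)
qed

text \<open>Otherwise resolving on the variable would save a clause.\<close>

lemma min_par_enc_guess_occs:
  assumes F: "min_par_enc I F" and guess: "lit_var l \<notin> I" and occ: "occs (neg l) F \<noteq> {}"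
  shows "card (occs l F) \<ge> 2"
proof (rule ccontr)
  assume *: "\<not> card (occs l F) \<ge> 2"
  note fin = min_par_encD(2)[OF F]
  have agree: "set_true {l'} a v = a v" if "v \<in> I" "lit_var l' = lit_var l" for a l' v
    using that guess by (metis image_empty image_insert set_true_outside singletonD)
  consider "occs l F = {}" | A where "occs l F = {A}"
    using * fin by (metis One_nat_def card_0_eq card_1_singletonE finite_occs less_2_cases not_le)
  then show False
  proof cases
    case 1
    \<comment> \<open>The pure literal \<open>neg l\<close> may be made true, which satisfies all
      deleted clauses.\<close>
    let ?G = "F - occs (neg l) F"
    have "cnf_sat (set_true {neg l} a) F" if "cnf_sat a ?G" for a
      unfolding cnf_sat_def
    proof
      fix C assume C: "C \<in> F"
      show "clause_sat (set_true {neg l} a) C"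
      proof (cases "neg l \<in> C")
        case True
        then show ?thesis by (auto simp: clause_sat_def lit_sat_set_true)
      next
        case False
        then have "clause_sat a C"
          using that C by (auto simp: cnf_sat_def occs_def)
        then obtain l' where "l' \<in> C" "lit_sat a l'"
          unfolding clause_sat_def by blast
        moreover have "l' \<noteq> l" using 1 C \<open>l' \<in> C\<close> by (auto simp: occs_def)
        ultimately show ?thesis by (auto simp: clause_sat_def lit_sat_set_true)
      qed
    qed
    then have "proj I ?G a \<longleftrightarrow> proj I F a" for a
      unfolding proj_def using agree[of _ "neg l"]
      by (metis (no_types, lifting) DiffD1 cnf_sat_def lit_var_neg)
    moreover have "card ?G < card F"
      using occ fin by (intro psubset_card_mono) (auto simp: occs_def)
    ultimately show False
      using not_min_par_enc[OF F, of ?G] fin by blast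
  next
    case (2 A)
    then have A: "A \<in> F" "l \<in> A" by (auto simp: occs_def)
    have A': "neg l \<notin> A" using min_par_enc_no_tautology[OF F A] .
    \<comment> \<open>Davis-Putnam elimination: each clause with \<open>neg l\<close> is replaced by
      its resolvent with \<open>A\<close>, and \<open>A\<close> itself is saved.\<close>
    let ?R = "F - occs l F - occs (neg l) F"
    let ?res = "\<lambda>B. (A - {l}) \<union> (B - {neg l})"
    let ?G = "?R \<union> ?res ` occs (neg l) F"
    have only: "C = A" if "C \<in> F" "l \<in> C" for C using 2 that by (auto simp: occs_def)
    have down: "cnf_sat a ?G" if a: "cnf_sat a F" for a
      unfolding cnf_sat_def
    proof
      fix C assume "C \<in> ?G"
      then consider "C \<in> F" | B where "B \<in> F" "C = ?res B" by (auto simp: occs_def)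
      then show "clause_sat a C"
      proof cases
        case 1 then show ?thesis using a by (auto simp: cnf_sat_def)
      next
        case (2 B)
        then have "clause_sat a A" "clause_sat a B" using a A by (auto simp: cnf_sat_def)
        then show ?thesis unfolding 2 clause_sat_def by (metis Diff_iff Un_iff lit_sat_neg singletonD)
      qed
    qed
    \<comment> \<open>If the rest of \<open>A\<close> holds, \<open>l\<close> is made false.
      Otherwise the resolvents yield the rest of every clause with \<open>neg l\<close>, and
      \<open>l\<close> can be made true.\<close>
    have up: "\<exists>l'. lit_var l' = lit_var l \<and> cnf_sat (set_true {l'} a) F" if a: "cnf_sat a ?G" for a
    proof (cases "clause_sat a (A - {l})")
      case True
      have "clause_sat (set_true {neg l} a) C" if C: "C \<in> F" for C
      proof (cases "neg l \<in> C")
        case True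
        then show ?thesis by (auto simp: clause_sat_def lit_sat_set_true)
      next
        case False
        have "clause_sat a (C - {l})"
        proof (cases "l \<in> C")
          case True then show ?thesis using only[OF C] \<open>clause_sat a (A - {l})\<close> by simp
        next
          case False
          then have "C \<in> ?R" using C \<open>neg l \<notin> C\<close> by (auto simp: occs_def)
          then show ?thesis using a False by (simp add: cnf_sat_def)
        qed
        then show ?thesis by (auto simp: clause_sat_def lit_sat_set_true)
      qed
      then show ?thesis by (intro exI[of _ "neg l"]) (simp add: cnf_sat_def)
    next
      case False
      have "clause_sat (set_true {l} a) C" if C: "C \<in> F" for C
      proof (cases "l \<in> C")
        case True
        then show ?thesis by (auto simp: clause_sat_def lit_sat_set_true)
      next
        case l: False
        have "clause_sat a (C - {neg l})"
        proof (cases "neg l \<in> C")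
          case True
          then have "?res C \<in> ?G" using C by (auto simp: occs_def)
          then have "clause_sat a (?res C)" using a unfolding cnf_sat_def by blast
          then show ?thesis using False unfolding clause_sat_def by blast
        next
          case False
          then have "C \<in> ?R" using C l by (auto simp: occs_def)
          then show ?thesis using a False by (simp add: cnf_sat_def)
        qed
        then show ?thesis using l unfolding clause_sat_def
          by (metis DiffD1 DiffD2 consistent_singleton insertI1 lit_sat_set_true neg_neg singletonD)
      qed
      then show ?thesis by (intro exI[of _ l]) (simp add: cnf_sat_def)
    qed
    have "proj I ?G a \<longleftrightarrow> proj I F a" for a
      unfolding proj_def using agree down up by metis
    moreover have "card ?G < card F"
    proof -
      have "card ?G \<le> card ?R + card (occs (neg l) F)"
        using fin by (intro order.trans[OF card_Un_le] add_mono card_image_le) auto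
      also have "\<dots> = card (?R \<union> occs (neg l) F)"
        using fin by (intro card_Un_disjoint[symmetric]) auto
      also have "\<dots> < card F"
        using A A' fin by (intro psubset_card_mono) (auto simp: occs_def)
      finally show ?thesis .
    qed
    ultimately show False
      using not_min_par_enc[OF F, of ?G] fin by simp
  qed
qed

section \<open>Occurrences of input literals\<close>

text \<open>Some input is left over by \<open>L\<close>, and its value can be chosen to make the
  parity right.\<close>

lemma exists_solution_literals:
  assumes "par_enc I F" "finite I" "card L < card I" "finite L" "consistent L" "lit_var ` L \<subseteq> I"
  obtains a where "cnf_sat a F" "\<And>l. l \<in> L \<Longrightarrow> lit_sat a l"
proof -
  have "card (lit_var ` L) < card I"
    using card_image_le[OF assms(4), of lit_var] assms(3) by linarith
  then obtain v where v: "v \<in> I" "v \<notin> lit_var ` L"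
    using assms by (meson card_mono finite_imageI leD subsetI)
  obtain a' where a': "cnf_sat a' F" "\<And>u. u \<in> I - {v} \<Longrightarrow> a' u = set_true L (\<lambda>_. False) u"
    using par_enc_solution[OF assms(1) v(1)] by blast
  have "lit_sat a' l" if "l \<in> L" for l
  proof -
    have "lit_sat (set_true L (\<lambda>_. False)) l" using assms(5) that by (simp add: lit_sat_set_true)
    moreover have "a' (lit_var l) = set_true L (\<lambda>_. False) (lit_var l)"
      using that v assms(6) by (intro a'(2)) auto
    ultimately show ?thesis using lit_sat_cong by metis
  qed
  then show ?thesis using that a'(1) by blast
qed

text \<open>Flipping the input of \<open>l\<close> in a solution must violate some clause.\<close>

lemma critical_clause:
  assumes F: "par_enc I F" and l: "lit_var l \<in> I" and a: "cnf_sat a F" "lit_sat a l"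
  obtains C where "C \<in> F" "l \<in> C" "\<And>l'. l' \<in> C \<Longrightarrow> l' \<noteq> l \<Longrightarrow> \<not> lit_sat a l'"
proof -
  let ?b = "a(lit_var l := \<not> a (lit_var l))"
  obtain C where C: "C \<in> F" "\<not> clause_sat ?b C"
    using par_enc_flip[OF F l a(1)] by (auto simp: cnf_sat_def)
  have same: "lit_sat ?b l' = lit_sat a l'" if "lit_var l' \<noteq> lit_var l" for l'
    using that by (intro lit_sat_cong) simp
  have b: "\<not> lit_sat ?b l" using a(2) by (cases l) auto
  then have "neg l \<notin> C" using C(2) by (auto simp: clause_sat_def)
  then have others: "\<not> lit_sat a l'" if "l' \<in> C" "l' \<noteq> l" for l'
    using C(2) that same[of l'] lit_var_eq_iff[of l' l] by (auto simp: clause_sat_def)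
  moreover have "clause_sat a C" using a C by (auto simp: cnf_sat_def)
  ultimately have "l \<in> C" by (auto simp: clause_sat_def)
  then show ?thesis using that C(1) others by blast
qed

text \<open>A second input corrects the parity of a point where \<open>l\<close> holds; the critical
  clause there contains \<open>l\<close>.\<close>

lemma input_occurs:
  assumes F: "par_enc I F" "finite I" "card I \<ge> 2" and l: "lit_var l \<in> I"
  shows "occs l F \<noteq> {}"
proof -
  obtain a where "cnf_sat a F" "lit_sat a l"
    using exists_solution_literals[OF F(1,2), of "{l}"] F(3) l by auto
  then obtain C where "C \<in> F" "l \<in> C"
    using critical_clause[OF F(1) l] by blast
  then show ?thesis by (auto simp: occs_def)
qed

text \<open>The critical clause for \<open>l\<close> can only be \<open>A\<close>, so
  \<open>l\<close> is its only true literal. Thus \<open>l\<close> forces the values of the other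
  literals of \<open>A\<close>.\<close>

lemma single_occ_false:
  assumes F: "par_enc I F" and l: "lit_var l \<in> I" and A: "occs l F = {A}"
    and a: "cnf_sat a F" "lit_sat a l" and l': "l' \<in> A" "l' \<noteq> l"
  shows "\<not> lit_sat a l'"
  using critical_clause[OF F l a] A l' by (metis (mono_tags, lifting) mem_Collect_eq occs_def singletonD)

text \<open>Two inputs of \<open>A\<close> could be made true together, a third one correcting the
  parity, against \<open>single_occ_false\<close>.\<close>

lemma single_occ_guess:
  assumes F: "min_par_enc I F" "finite I" "card I \<ge> 3" and l: "lit_var l \<in> I"
    and A: "occs l F = {A}" and l': "l' \<in> A" "l' \<noteq> l"
  shows "lit_var l' \<notin> I"
proof
  assume l'I: "lit_var l' \<in> I"
  have "A \<in> F" "l \<in> A" using A by (auto simp: occs_def)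
  then have "neg l \<noteq> l'" using min_par_enc_no_tautology[OF F(1)] l'(1) by blast
  then have "consistent {l, l'}"
    using l' by (auto simp: consistent_def)
  moreover have "card {l, l'} < card I" using F(3) l'(2) by simp
  ultimately obtain a where "cnf_sat a F" "lit_sat a l" "lit_sat a l'"
    using exists_solution_literals[OF min_par_encD(1)[OF F(1)] F(2), of "{l, l'}"] l l'I
    by (metis empty_subsetI finite.emptyI finite.insertI image_empty image_insert insertCI insert_subset)
  then show False
    using single_occ_false[OF min_par_encD(1)[OF F(1)] l A _ _ l'] by blast
qed

text \<open>If the only clause with \<open>l\<close> were \<open>{l, y}\<close>, then \<open>y\<close> would be equivalent to the
  negation of \<open>l\<close> and could be substituted, which makes that clause redundant.\<close>

lemma single_occ_width:
  assumes F: "min_par_enc I F" "finite I" "card I \<ge> 3" and l: "lit_var l \<in> I"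
    and A: "occs l F = {A}"
  obtains y1 y2 where "y1 \<in> A" "y2 \<in> A" "y1 \<noteq> l" "y2 \<noteq> l" "y1 \<noteq> y2"
proof -
  note enc = min_par_encD(1)[OF F(1)] and fin = min_par_encD(2)[OF F(1)]
  have AF: "A \<in> F" "l \<in> A" using A by (auto simp: occs_def)
  \<comment> \<open>A unit clause would fix an input.\<close>
  have "A \<noteq> {l}"
  proof
    assume "A = {l}"
    moreover obtain a where "cnf_sat a F" "lit_sat a (neg l)"
      using exists_solution_literals[OF enc F(2), of "{neg l}"] F(3) l by auto
    ultimately show False using AF by (auto simp: cnf_sat_def clause_sat_def)
  qed
  then obtain y where y: "y \<in> A" "y \<noteq> l" using AF by blast
  have "A \<noteq> {l, y}"
  proof
    assume Ay: "A = {l, y}"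
    have yI: "lit_var y \<notin> I" using single_occ_guess[OF F l A y] .
    \<comment> \<open>The substitution of \<open>neg l\<close> for \<open>y\<close> on literals; on
      assignments it corresponds to \<open>b\<close>, which gives \<open>y\<close> the value of
      \<open>neg l\<close>.\<close>
    define \<sigma> where "\<sigma> l' = (if l' = y then neg l else if l' = neg y then l else l')" for l'
    define b where "b a = set_true {if lit_sat a l then neg y else y} a" for a
    have neq: "lit_var y \<noteq> lit_var l" using l yI by auto
    have bI: "b a v = a v" if "v \<in> I" for a v
      using that yI unfolding b_def by (intro set_true_outside) auto
    have bl: "lit_sat (b a) l \<longleftrightarrow> lit_sat a l" for a
      by (intro lit_sat_cong bI l)
    have by': "lit_sat (b a) y \<longleftrightarrow> \<not> lit_sat a l" for a
      by (simp add: b_def lit_sat_set_true)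
    have \<sigma>: "lit_sat a (\<sigma> l') \<longleftrightarrow> lit_sat (b a) l'" for a l'
    proof (cases "lit_var l' = lit_var y")
      case True
      then show ?thesis using by'[of a] by (auto simp: \<sigma>_def lit_var_eq_iff)
    next
      case False
      then have "b a (lit_var l') = a (lit_var l')"
        unfolding b_def by (intro set_true_outside) auto
      then show ?thesis using False lit_sat_cong[of "b a" l' a] by (auto simp: \<sigma>_def)
    qed
    let ?G = "(\<lambda>C. \<sigma> ` C) ` (F - {A})"
    have "clause_sat (b a) A" for a
      unfolding Ay clause_sat_def using bl by' by auto
    then have sat: "cnf_sat a ?G \<longleftrightarrow> cnf_sat (b a) F" for a
      by (auto simp: cnf_sat_def clause_sat_def \<sigma>)
    \<comment> \<open>Solutions satisfy the equivalence already: \<open>A\<close> gives one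
      direction, \<open>single_occ_false\<close> the other.\<close>
    have id: "b a = a" if "cnf_sat a F" for a
    proof -
      have "clause_sat a A" using that AF by (auto simp: cnf_sat_def)
      then have "lit_sat a y \<longleftrightarrow> \<not> lit_sat a l"
        using single_occ_false[OF enc l A that _ y] by (auto simp: Ay clause_sat_def)
      then show ?thesis unfolding b_def by (intro set_true_id) auto
    qed
    have "proj I ?G a \<longleftrightarrow> proj I F a" for a
      unfolding proj_def sat using id bI by metis
    moreover have "card ?G < card F"
      using AF(1) fin by (meson card_Diff1_less card_image_le finite_Diff le_less_trans)
    ultimately show False
      using not_min_par_enc[OF F(1), of ?G] fin by blast
  qed
  then obtain y2 where "y2 \<in> A" "y2 \<noteq> l" "y2 \<noteq> y" using AF y by blast
  then show ?thesis using that y by blast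
qed

text \<open>Making \<open>l\<close> true satisfies \<open>A\<close> and forces all literals of
  \<open>Z\<close> to be false, so every clause with the negation of one of them disappears too. As
  \<open>A\<close> is no tautology, it is not among these, whence the \<open>Suc\<close>.\<close>

lemma single_occ_restrict:
  assumes F: "min_par_enc I F" "finite I" "card I \<ge> 3" and l: "lit_var l \<in> I"
    and A: "occs l F = {A}" and Z: "Z \<subseteq> A - {l}"
  shows "\<exists>G. par_enc (I - {lit_var l}) G \<and>
    card G + Suc (card {C\<in>F. C \<inter> neg ` Z \<noteq> {}}) \<le> card F"
proof -
  note enc = min_par_encD(1)[OF F(1)] and fin = min_par_encD(2)[OF F(1)]
  have AF: "A \<in> F" "l \<in> A" using A by (auto simp: occs_def)
  let ?L = "insert l (neg ` Z)"
  have nt: "neg l' \<notin> A" if "l' \<in> A" for l'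
    using min_par_enc_no_tautology[OF F(1) AF(1) that] .
  have con: "consistent ?L"
  proof -
    have "neg l' \<notin> Z" if "l' \<in> Z" for l' using nt Z that by blast
    moreover have "neg l \<notin> Z" using nt[OF AF(2)] Z by blast
    ultimately show ?thesis using Z unfolding consistent_def by (force simp: image_iff)
  qed
  have "par_enc (I - {lit_var l}) (restrict_cnf ?L F)"
  proof (rule par_enc_restrict[OF enc con])
    fix l' assume "l' \<in> ?L" "l' \<noteq> l"
    then obtain z where "z \<in> A" "z \<noteq> l" "l' = neg z" using Z by blast
    then show "lit_var l' \<notin> I"
      using single_occ_guess[OF F l A] by simp
  next
    fix a l' assume "cnf_sat a F" "lit_sat a l" "l' \<in> ?L"
    then consider "l' = l" | z where "z \<in> A" "z \<noteq> l" "l' = neg z" using Z by blast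
    then show "lit_sat a l'"
      by cases (use \<open>lit_sat a l\<close> single_occ_false[OF enc l A \<open>cnf_sat a F\<close> \<open>lit_sat a l\<close>] in auto)
  qed (use l in auto)
  moreover have "Suc (card {C\<in>F. C \<inter> neg ` Z \<noteq> {}}) \<le> card {C\<in>F. C \<inter> ?L \<noteq> {}}"
  proof -
    have "A \<inter> neg ` Z = {}" using nt Z by auto
    then have "Suc (card {C\<in>F. C \<inter> neg ` Z \<noteq> {}}) = card (insert A {C\<in>F. C \<inter> neg ` Z \<noteq> {}})"
      using fin by simp
    also have "\<dots> \<le> card {C\<in>F. C \<inter> ?L \<noteq> {}}"
      using fin AF by (intro card_mono) auto
    finally show ?thesis .
  qed
  ultimately show ?thesis
    using card_restrict[OF fin, of ?L] by (intro exI[of _ "restrict_cnf ?L F"]) linarith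
qed

text \<open>Besides \<open>A\<close>, at least two clauses with the negation of a guess literal of
  \<open>A\<close> disappear.\<close>

lemma single_occ_saves_3:
  assumes F: "min_par_enc I F" "finite I" "card I \<ge> 3" and l: "lit_var l \<in> I"
    and A: "occs l F = {A}"
  shows "\<exists>G. par_enc (I - {lit_var l}) G \<and> card G + 3 \<le> card F"
proof -
  obtain y where y: "y \<in> A" "y \<noteq> l" using single_occ_width[OF F l A] by blast
  have "card (occs (neg y) F) \<ge> 2"
    using y A single_occ_guess[OF F l A y]
    by (intro min_par_enc_guess_occs[OF F(1)]) (auto simp: occs_def)
  moreover have "{C\<in>F. C \<inter> neg ` {y} \<noteq> {}} = occs (neg y) F" by (auto simp: occs_def)
  ultimately show ?thesis
    using single_occ_restrict[OF F l A, of "{y}"] y by fastforce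
qed

text \<open>With two guess literals of \<open>A\<close> forced at once, at least three clauses
  disappear besides \<open>A\<close>.\<close>

lemma single_occ_saves_4:
  assumes F: "min_par_enc I F" "finite I" "card I \<ge> 3" and l: "lit_var l \<in> I"
    and A: "occs l F = {A}"
  shows "\<exists>G. par_enc (I - {lit_var l}) G \<and> card G + 4 \<le> card F"
proof -
  note enc = min_par_encD(1)[OF F(1)] and fin = min_par_encD(2)[OF F(1)]
  obtain y1 y2 where y: "y1 \<in> A" "y2 \<in> A" "y1 \<noteq> l" "y2 \<noteq> l" "y1 \<noteq> y2"
    using single_occ_width[OF F l A] by blast
  have AF: "A \<in> F" using A by (auto simp: occs_def)
  have y2I: "lit_var y2 \<notin> I" using single_occ_guess[OF F l A] y by blast
  have two: "card (occs (neg y) F) \<ge> 2" if "y \<in> A" "y \<noteq> l" for y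
    using that A single_occ_guess[OF F l A that]
    by (intro min_par_enc_guess_occs[OF F(1)]) (auto simp: occs_def)
  have un: "{C\<in>F. C \<inter> neg ` {y1, y2} \<noteq> {}} = occs (neg y1) F \<union> occs (neg y2) F"
    by (auto simp: occs_def)
  \<comment> \<open>Otherwise \<open>neg y1\<close> and \<open>neg y2\<close> occur in the same clauses. All of them contain the true literal
    \<open>neg y1\<close> when \<open>l\<close> is true, so \<open>y2\<close> could be made true as well.\<close>
  have "card (occs (neg y1) F \<union> occs (neg y2) F) \<ge> 3"
  proof (rule ccontr)
    assume "\<not> ?thesis"
    then have "occs (neg y1) F = occs (neg y1) F \<union> occs (neg y2) F"
      using two[of y1] y fin by (intro card_seteq) auto
    then have sub: "neg y1 \<in> C" if "C \<in> F" "neg y2 \<in> C" for C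
      using that by (auto simp: occs_def)
    obtain a where a: "cnf_sat a F" "lit_sat a l"
      using exists_solution_literals[OF enc F(2), of "{l}"] F(3) l by auto
    have y1: "\<not> lit_sat a y1" using single_occ_false[OF enc l A a] y by blast
    let ?b = "set_true {y2} a"
    have ne: "neg y1 \<noteq> y2" using min_par_enc_no_tautology[OF F(1) AF y(1)] y(2) by blast
    have "clause_sat ?b C" if C: "C \<in> F" for C
    proof (cases "neg y2 \<in> C")
      case True
      then have "neg y1 \<in> C" using sub C by blast
      moreover have "lit_sat ?b (neg y1)" using y1 y ne by (simp add: lit_sat_set_true)
      ultimately show ?thesis unfolding clause_sat_def by blast
    next
      case False
      then show ?thesis using a(1) C unfolding cnf_sat_def clause_sat_def
        by (metis consistent_singleton lit_sat_set_true neg_neg singletonD)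
    qed
    then have "cnf_sat ?b F" by (simp add: cnf_sat_def)
    moreover have "lit_sat ?b l"
      using a(2) l y2I lit_sat_cong[of ?b l a] set_true_outside[of "lit_var l" "{y2}" a]
      by (metis image_empty image_insert singletonD)
    moreover have "lit_sat ?b y2" by (simp add: lit_sat_set_true)
    ultimately show False using single_occ_false[OF enc l A] y by blast
  qed
  then show ?thesis
    using single_occ_restrict[OF F l A, of "{y1, y2}"] y unfolding un by fastforce
qed

section \<open>Induction on the number of inputs\<close>

lemma restrict_input:
  assumes F: "par_enc I F" and l: "lit_var l \<in> I"
  shows "par_enc (I - {lit_var l}) (restrict_cnf {l} F)"
    "card (restrict_cnf {l} F) + card (occs l F) \<le> card F"
proof -
  show "par_enc (I - {lit_var l}) (restrict_cnf {l} F)"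
    by (rule par_enc_restrict[OF F consistent_singleton _ l]) auto
  have "{C\<in>F. C \<inter> {l} \<noteq> {}} = occs l F" by (auto simp: occs_def)
  then show "card (restrict_cnf {l} F) + card (occs l F) \<le> card F"
    using card_restrict[of F "{l}"] F by (simp add: par_enc_def)
qed

lemma many_clauses_if_not_shared:
  assumes fin: "finite F" "finite I"
    and two: "\<And>l. lit_var l \<in> I \<Longrightarrow> card (occs l F) = 2"
    and nonshared: "\<And>C l l'. C \<in> F \<Longrightarrow> l \<in> C \<Longrightarrow> l' \<in> C \<Longrightarrow> lit_var l \<in> I \<Longrightarrow> lit_var l' \<in> I \<Longrightarrow> l = l'"
  shows "4 * card I \<le> card F"
proof -
  let ?L = "Pos ` I \<union> Neg ` I"
  have L: "lit_var l \<in> I" if "l \<in> ?L" for l using that by auto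
  have cardL: "card ?L = 2 * card I"
    using fin by (subst card_Un_disjoint) (auto simp: card_image inj_on_def)
  have disj: "occs l F \<inter> occs l' F = {}" if "l \<in> ?L" "l' \<in> ?L" "l \<noteq> l'" for l l'
    using nonshared[of _ l l'] L[OF that(1)] L[OF that(2)] that(3) unfolding occs_def by blast
  have "card (\<Union>l\<in>?L. occs l F) = (\<Sum>l\<in>?L. card (occs l F))"
    using fin disj by (intro card_UN_disjoint) auto
  also have "\<dots> = (\<Sum>l\<in>?L. 2)" using two L by (intro sum.cong) auto
  also have "\<dots> = 4 * card I" using cardL by simp
  finally have "4 * card I = card (\<Union>l\<in>?L. occs l F)" by simp
  also have "\<dots> \<le> card F" using fin by (intro card_mono) (auto simp: occs_def)
  finally show ?thesis .
qed

text \<open>The offset 9 covers up to three inputs. From four on, three inputs remain after fixing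
  one, as \<open>single_occ_saves_4\<close> requires.\<close>

lemma par_enc_size:
  assumes "finite I" "par_enc I F"
  shows "3 * card I \<le> card F + 9"
  using assms
proof (induction "card I" arbitrary: I F rule: less_induct)
  case less
  show ?case
  proof (cases "card I \<le> 3")
    case False
    then have n: "card I \<ge> 4" by simp
    obtain G where G: "min_par_enc I G" "card G \<le> card F"
      using exists_min_par_enc less.prems by blast
    note enc = min_par_encD(1)[OF G(1)] and fin = min_par_encD(2)[OF G(1)]
    note finI = less.prems(1)
    have cardI: "card (I - {lit_var l}) = card I - 1" if "lit_var l \<in> I" for l :: "'a literal"
      using that finI by simp
    have IH1: "3 * card I \<le> card H + 12" if "par_enc (I - {lit_var l}) H" "lit_var l \<in> I" for l H
      using less.hyps[of "I - {lit_var l}" H] that finI n cardI[of l] by simp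
    have "3 * card I \<le> card G + 9"
    proof (cases "\<forall>l. lit_var l \<in> I \<longrightarrow> card (occs l G) = 2")
      case False
      then obtain l where l: "lit_var l \<in> I" "card (occs l G) \<noteq> 2" by blast
      show ?thesis
      proof (cases "card (occs l G) \<ge> 3")
        case True
        then show ?thesis
          using IH1[OF restrict_input(1)[OF enc l(1)] l(1)] restrict_input(2)[OF enc l(1)] by linarith
      next
        case False
        moreover have "card (occs l G) \<noteq> 0"
          using input_occurs[OF enc finI _ l(1)] n fin by simp
        ultimately have "card (occs l G) = 1" using l(2) by linarith
        then obtain A where "occs l G = {A}" by (rule card_1_singletonE)
        then obtain H where "par_enc (I - {lit_var l}) H" "card H + 3 \<le> card G"
          using single_occ_saves_3[OF G(1) finI _ l(1)] n by auto
        then show ?thesis using IH1 l(1) by fastforce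
      qed
    next
      case two: True
      show ?thesis
      proof (cases "\<exists>C\<in>G. \<exists>l\<in>C. \<exists>l'\<in>C. lit_var l \<in> I \<and> lit_var l' \<in> I \<and> l \<noteq> l'")
        case False
        then have "4 * card I \<le> card G"
          using two by (intro many_clauses_if_not_shared[OF fin finI]) blast+
        then show ?thesis by linarith
      next
        case True
        then obtain C l l' where C: "C \<in> G" "l \<in> C" "l' \<in> C" and l: "lit_var l \<in> I" "lit_var l' \<in> I" "l \<noteq> l'"
          by blast
        have "neg l \<notin> C" using min_par_enc_no_tautology[OF G(1) C(1,2)] .
        then have var: "lit_var l' \<noteq> lit_var l" using C l(3) by (auto simp: lit_var_eq_iff)
        let ?I = "I - {lit_var l}" and ?H = "restrict_cnf {l} G"
        note H = restrict_input[OF enc l(1)]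
        have cH: "card ?H + 2 \<le> card G" using H(2) two l(1) by simp
        \<comment> \<open>Restricting \<open>l\<close> removes two clauses. If the result is not
          minimal, a smaller encoding saves the third.\<close>
        show ?thesis
        proof (cases "min_par_enc ?I ?H")
          case False
          then obtain K where "par_enc ?I K" "card K < card ?H"
            using H(1) unfolding min_par_enc_def by (metis not_le)
          then show ?thesis using IH1[of l K] l(1) cH by simp
        next
          case minH: True
          have finI': "finite ?I" and n': "card ?I \<ge> 3" using finI n cardI[OF l(1)] by simp_all
          have l': "lit_var l' \<in> ?I" using l(2) var by simp
          \<comment> \<open>The shared clause \<open>C\<close> is satisfied by \<open>l\<close>, so
            at most one of the two clauses with \<open>l'\<close> survives. Then \<open>l'\<close>
            has a single occurrence and saves four more clauses.\<close>
          have "occs l' ?H \<subseteq> (\<lambda>C. C - {neg l}) ` (occs l' G - {C})"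
            using C var by (auto simp: occs_def restrict_cnf_def)
          then have "card (occs l' ?H) \<le> card (occs l' G - {C})"
            using fin by (intro surj_card_le) auto
          also have "\<dots> = 1" using two l(2) C fin by (subst card_Diff_singleton) (auto simp: occs_def)
          finally have "card (occs l' ?H) \<le> 1" .
          moreover have "card (occs l' ?H) \<noteq> 0"
            using input_occurs[OF H(1) finI' _ l'] n' min_par_encD(2)[OF minH] by simp
          ultimately have "card (occs l' ?H) = 1" by linarith
          then obtain A where "occs l' ?H = {A}" by (rule card_1_singletonE)
          then obtain K where K: "par_enc (?I - {lit_var l'}) K" "card K + 4 \<le> card ?H"
            using single_occ_saves_4[OF minH finI' n' l'] by blast
          have "card (?I - {lit_var l'}) = card I - 2"
            using l' finI' cardI[OF l(1)] by simp
          then show ?thesis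
            using less.hyps[of "?I - {lit_var l'}" K] K finI n cH by simp
        qed
      qed
    qed
    then show ?thesis using G(2) by linarith
  qed simp
qed

text \<open>The projection to the inputs is \<open>PAR n\<close> itself, since an assignment on
  \<open>var\<close> amounts to a pair of an input point and guesses.\<close>

lemma encodes_imp_par_enc:
  assumes "encodes n s F (PAR n)"
  shows "par_enc (X ` {..<n}) F"
proof -
  have proj: "proj (X ` {..<n}) F a \<longleftrightarrow> PAR n (\<lambda>i. a (X i))" for a
  proof
    assume "proj (X ` {..<n}) F a"
    then obtain a' where a': "\<And>i. i < n \<Longrightarrow> a' (X i) = a (X i)" "cnf_sat a' F"
      by (auto simp: proj_def)
    have "a' = case_var (\<lambda>i. a' (X i)) (\<lambda>j. a' (Y j))"
      by (rule ext) (simp split: var.split)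
    then have "PAR n (\<lambda>i. a' (X i))"
      using assms a'(2) unfolding encodes_def by metis
    then show "PAR n (\<lambda>i. a (X i))" using PAR_cong a'(1) by metis
  next
    assume "PAR n (\<lambda>i. a (X i))"
    then obtain y where "cnf_sat (case_var (\<lambda>i. a (X i)) y) F"
      using assms by (auto simp: encodes_def)
    then show "proj (X ` {..<n}) F a"
      unfolding proj_def by (intro exI[of _ "case_var (\<lambda>i. a (X i)) y"]) auto
  qed
  have "PAR n (\<lambda>j. (a(X i := \<not> a (X i))) (X j)) \<longleftrightarrow> \<not> PAR n (\<lambda>j. a (X j))" if "i < n" for a i
  proof -
    have "(\<lambda>j. (a(X i := \<not> a (X i))) (X j)) = (\<lambda>j. a (X j))(i := \<not> a (X i))"
      by (auto simp: fun_eq_iff)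
    then show ?thesis using PAR_flip[OF that, of "\<lambda>j. a (X j)"] by simp
  qed
  then show ?thesis
    using assms unfolding par_enc_def proj encodes_def is_cnf_def ball_simps by simp
qed

theorem theorem1:
  "(\<exists>c::real. c > 0 \<and>
      (\<forall>(n::nat) (s::nat) (F::var cnf) (m::nat).
         n \<ge> 1 \<and> encodes n s F (PAR n) \<and> m = cnf_size F \<and> s \<le> n * m \<longrightarrow>
         real m \<ge> c * ((real s + 1) / real n) * 2 powr (real n / (real s + 1)))) \<and>
   (\<forall>(n::nat) (s::nat) (F::var cnf) (m::nat) (k::nat).
      n \<ge> 1 \<and> encodes n s F (PAR n) \<and> m = cnf_size F \<and> k = max_width F \<longrightarrow>
      real k \<ge> real n / (real s + 1) \<and>
      real m \<ge> 3 * real n - 9)"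
proof -
  have "real m \<ge> 1 / 8 * ((real s + 1) / real n) * 2 powr (real n / (real s + 1))"
    if "n \<ge> 1 \<and> encodes n s F (PAR n) \<and> m = cnf_size F \<and> s \<le> n * m" for n s F m
  proof -
    have m: "m = card F" using that by (simp add: cnf_size_def)
    show ?thesis using PAR_size[of n s F] that unfolding m by blast
  qed
  moreover have "real k \<ge> real n / (real s + 1) \<and> real m \<ge> 3 * real n - 9"
    if *: "n \<ge> 1 \<and> encodes n s F (PAR n) \<and> m = cnf_size F \<and> k = max_width F" for n s F m k
  proof -
    have "card (X ` {..<n}) = n" by (simp add: card_image inj_on_def)
    then have "3 * n \<le> m + 9"
      using par_enc_size[OF _ encodes_imp_par_enc, of n s F] * by (simp add: cnf_size_def)
    then show ?thesis using PAR_width[of n s F] * by simp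
  qed
  ultimately show ?thesis
    by (intro conjI exI[of _ "1 / 8"]) (simp, blast+)
qed

end
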